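(* Let $n\ge1$ and $\Theta\subseteq\mathsf{FORM}_n$. If there exists a Bouligand–Severi rational outgoing tangent vector to $\mathrm{Mod}(\Theta)$ at some rational point $v$ of $\mathrm{Mod}(\Theta)$, then $\mathsf{LIND}(\mathrm{Th}(\mathrm{Mod}(\Theta)))$ is semisimple but not strongly semisimple.
   Context: $\mathsf{FORM}_n$ is the set of formulas of infinite-valued Łukasiewicz propositional logic in $X_1,\dots,X_n$; $\vdash$ is derivability (Łukasiewicz axioms, Modus Ponens). For $\Phi\subseteq\mathsf{FORM}_n$, $\mathsf{LIND}(\Phi)$ is $\mathsf{FORM}_n$ modulo $\phi\equiv_\Phi\psi$ iff $\Phi\vdash\phi\leftrightarrow\psi$, an MV-algebra. An MV-algebra is semisimple if the intersection of its maximal ideals is $\{0\}$, strongly semisimple if its quotient by every principal ideal is semisimple. Each $\phi$ determines $\hat\phi\colon[0,1]^n\to[0,1]$ (truth value at valuation $v$, with $\neg x=1-x$, $x\oplus y=\min(1,x+y)$). $\mathrm{Mod}(\Theta)=\{v\in[0,1]^n\mid\hat\theta(v)=1\ \forall\theta\in\Theta\}$; for $X\subseteq[0,1]^n$, $\mathrm{Th}(X)=\{\psi\in\mathsf{FORM}_n\mid\hat\psi(w)=1\ \forall w\in X\}$. A point of $\mathbb R^n$ is rational if all coordinates are rational; a rational vector is a nonzero $w\in\mathbb R^n$ whose line $\mathbb Rw$ contains a rational point other than the origin. For closed $X\subseteq\mathbb R^n$, $x\in X$ and a unit vector $u$, $u$ is a Bouligand–Severi tangent vector to $X$ at $x$ if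 there are $x_i\in X\setminus\{x\}$ with $x_i\to x$ and $(x_i-x)/\|x_i-x\|\to u$; it is outgoing if the open segment $\mathrm{relint}(\mathrm{conv}(x,x+\mu u))$ is disjoint from $X$ for some $\mu>0$. *)

theory Defs
  imports "HOL-Analysis.Analysis"
begin

section \<open>Lukasiewicz formulas and derivability\<close>

text \<open>The variables \<open>X\<^sub>1, \<dots>, X\<^sub>n\<close> are indexed by the finite type \<open>'n\<close>, with \<open>n = CARD('n) \<ge> 1\<close>.
  The Lukasiewicz axioms are formulated for the primitive connectives \<open>\<not>\<close> and \<open>\<longrightarrow>\<close>; the
  connective \<open>\<oplus>\<close> is the usual derived one.\<close>

datatype 'n luk_form =
    Var 'n
  | Neg "'n luk_form"
  | Imp "'n luk_form" "'n luk_form"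

definition Oplus :: "'n luk_form \<Rightarrow> 'n luk_form \<Rightarrow> 'n luk_form" where
  "Oplus \<phi> \<psi> = Imp (Neg \<phi>) \<psi>"

definition Odot :: "'n luk_form \<Rightarrow> 'n luk_form \<Rightarrow> 'n luk_form" where
  "Odot \<phi> \<psi> = Neg (Oplus (Neg \<phi>) (Neg \<psi>))"

definition Iff :: "'n luk_form \<Rightarrow> 'n luk_form \<Rightarrow> 'n luk_form" where
  "Iff \<phi> \<psi> = Odot (Imp \<phi> \<psi>) (Imp \<psi> \<phi>)"

inductive luk_derives :: "'n luk_form set \<Rightarrow> 'n luk_form \<Rightarrow> bool"  (infix \<open>\<turnstile>\<close> 50)
  for \<Phi> :: "'n luk_form set" where
  Hyp: "\<phi> \<in> \<Phi> \<Longrightarrow> \<Phi> \<turnstile> \<phi>"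
| A1: "\<Phi> \<turnstile> Imp \<alpha> (Imp \<beta> \<alpha>)"
| A2: "\<Phi> \<turnstile> Imp (Imp \<alpha> \<beta>) (Imp (Imp \<beta> \<gamma>) (Imp \<alpha> \<gamma>))"
| A3: "\<Phi> \<turnstile> Imp (Imp (Imp \<alpha> \<beta>) \<beta>) (Imp (Imp \<beta> \<alpha>) \<alpha>)"
| A4: "\<Phi> \<turnstile> Imp (Imp (Neg \<alpha>) (Neg \<beta>)) (Imp \<beta> \<alpha>)"
| MP: "\<Phi> \<turnstile> \<alpha> \<Longrightarrow> \<Phi> \<turnstile> Imp \<alpha> \<beta> \<Longrightarrow> \<Phi> \<turnstile> \<beta>"


section \<open>MV-algebras\<close>

record 'a mv_structure =
  mv_carrier :: "'a set"
  mv_plus :: "'a \<Rightarrow> 'a \<Rightarrow> 'a"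
  mv_neg :: "'a \<Rightarrow> 'a"
  mv_zero :: 'a

locale mv_algebra =
  fixes A :: "('a, 'b) mv_structure_scheme"
  assumes zero_closed: "mv_zero A \<in> mv_carrier A"
    and neg_closed: "x \<in> mv_carrier A \<Longrightarrow> mv_neg A x \<in> mv_carrier A"
    and plus_closed: "x \<in> mv_carrier A \<Longrightarrow> y \<in> mv_carrier A \<Longrightarrow> mv_plus A x y \<in> mv_carrier A"
    and plus_assoc: "x \<in> mv_carrier A \<Longrightarrow> y \<in> mv_carrier A \<Longrightarrow> z \<in> mv_carrier A \<Longrightarrow>
      mv_plus A x (mv_plus A y z) = mv_plus A (mv_plus A x y) z"
    and plus_comm: "x \<in> mv_carrier A \<Longrightarrow> y \<in> mv_carrier A \<Longrightarrow> mv_plus A x y = mv_plus A y x"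
    and plus_zero: "x \<in> mv_carrier A \<Longrightarrow> mv_plus A x (mv_zero A) = x"
    and neg_neg: "x \<in> mv_carrier A \<Longrightarrow> mv_neg A (mv_neg A x) = x"
    and plus_one: "x \<in> mv_carrier A \<Longrightarrow> mv_plus A x (mv_neg A (mv_zero A)) = mv_neg A (mv_zero A)"
    and lukasiewicz: "x \<in> mv_carrier A \<Longrightarrow> y \<in> mv_carrier A \<Longrightarrow>
      mv_plus A (mv_neg A (mv_plus A (mv_neg A x) y)) y =
      mv_plus A (mv_neg A (mv_plus A (mv_neg A y) x)) x"

definition mv_le :: "('a, 'b) mv_structure_scheme \<Rightarrow> 'a \<Rightarrow> 'a \<Rightarrow> bool" where
  "mv_le A x y \<longleftrightarrow> mv_plus A (mv_neg A x) y = mv_neg A (mv_zero A)"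

definition mv_minus :: "('a, 'b) mv_structure_scheme \<Rightarrow> 'a \<Rightarrow> 'a \<Rightarrow> 'a" where
  "mv_minus A x y = mv_neg A (mv_plus A (mv_neg A x) y)"

definition mv_dist :: "('a, 'b) mv_structure_scheme \<Rightarrow> 'a \<Rightarrow> 'a \<Rightarrow> 'a" where
  "mv_dist A x y = mv_plus A (mv_minus A x y) (mv_minus A y x)"

definition mv_ideal :: "('a, 'b) mv_structure_scheme \<Rightarrow> 'a set \<Rightarrow> bool" where
  "mv_ideal A I \<longleftrightarrow>
     I \<subseteq> mv_carrier A \<and>
     mv_zero A \<in> I \<and>
     (\<forall>x\<in>I. \<forall>y\<in>I. mv_plus A x y \<in> I) \<and>
     (\<forall>x\<in>I. \<forall>y\<in>mv_carrier A. mv_le A y x \<longrightarrow> y \<in> I)"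

definition mv_maximal_ideal :: "('a, 'b) mv_structure_scheme \<Rightarrow> 'a set \<Rightarrow> bool" where
  "mv_maximal_ideal A M \<longleftrightarrow>
     mv_ideal A M \<and> M \<noteq> mv_carrier A \<and>
     (\<forall>J. mv_ideal A J \<longrightarrow> M \<subseteq> J \<longrightarrow> J = M \<or> J = mv_carrier A)"

definition mv_principal_ideal :: "('a, 'b) mv_structure_scheme \<Rightarrow> 'a \<Rightarrow> 'a set" where
  "mv_principal_ideal A a = \<Inter>{I. mv_ideal A I \<and> a \<in> I}"

definition mv_cong :: "('a, 'b) mv_structure_scheme \<Rightarrow> 'a set \<Rightarrow> ('a \<times> 'a) set" where
  "mv_cong A I = {(x, y). x \<in> mv_carrier A \<and> y \<in> mv_carrier A \<and> mv_dist A x y \<in> I}"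

definition mv_quotient :: "('a, 'b) mv_structure_scheme \<Rightarrow> 'a set \<Rightarrow> 'a set mv_structure" where
  "mv_quotient A I = \<lparr>
     mv_carrier = mv_carrier A // mv_cong A I,
     mv_plus = (\<lambda>X Y. \<Union>x\<in>X. \<Union>y\<in>Y. mv_cong A I `` {mv_plus A x y}),
     mv_neg = (\<lambda>X. \<Union>x\<in>X. mv_cong A I `` {mv_neg A x}),
     mv_zero = mv_cong A I `` {mv_zero A}\<rparr>"

text \<open>Intersecting with the carrier gives the empty intersection its usual value, so that the
  one-element algebra is semisimple.\<close>

definition mv_semisimple :: "('a, 'b) mv_structure_scheme \<Rightarrow> bool" where
  "mv_semisimple A \<longleftrightarrow> mv_carrier A \<inter> \<Inter>{M. mv_maximal_ideal A M} = {mv_zero A}"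

definition mv_strongly_semisimple :: "('a, 'b) mv_structure_scheme \<Rightarrow> bool" where
  "mv_strongly_semisimple A \<longleftrightarrow>
     (\<forall>a\<in>mv_carrier A. mv_semisimple (mv_quotient A (mv_principal_ideal A a)))"


section \<open>Lindenbaum algebras\<close>

definition lind_rel :: "'n luk_form set \<Rightarrow> ('n luk_form \<times> 'n luk_form) set" where
  "lind_rel \<Phi> = {(\<phi>, \<psi>). \<Phi> \<turnstile> Iff \<phi> \<psi>}"

text \<open>As there is no constant for falsum, the zero is given directly as the class of all refutable
  formulas.\<close>

definition LIND :: "'n luk_form set \<Rightarrow> 'n luk_form set mv_structure" where
  "LIND \<Phi> = \<lparr>
     mv_carrier = UNIV // lind_rel \<Phi>,
     mv_plus = (\<lambda>P Q. \<Union>\<phi>\<in>P. \<Union>\<psi>\<in>Q. lind_rel \<Phi> `` {Oplus \<phi> \<psi>}),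
     mv_neg = (\<lambda>P. \<Union>\<phi>\<in>P. lind_rel \<Phi> `` {Neg \<phi>}),
     mv_zero = {\<phi>. \<Phi> \<turnstile> Neg \<phi>}\<rparr>"

lemma luk_imp_trans: "\<Phi> \<turnstile> Imp a b \<Longrightarrow> \<Phi> \<turnstile> Imp b c \<Longrightarrow> \<Phi> \<turnstile> Imp a c"
  by (meson A2 MP)

lemma luk_imp_assert: "\<Phi> \<turnstile> Imp a (Imp (Imp a b) b)"
  using luk_imp_trans[OF A1 A3] .

lemma luk_imp_suffix: "\<Phi> \<turnstile> Imp a b \<Longrightarrow> \<Phi> \<turnstile> Imp (Imp b c) (Imp a c)"
  by (meson A2 MP)

lemma luk_imp_exchange: "\<Phi> \<turnstile> Imp (Imp a (Imp b c)) (Imp b (Imp a c))"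
  using luk_imp_trans[OF A2 luk_imp_suffix[OF luk_imp_assert]] .

lemma luk_imp_exchange_rule: "\<Phi> \<turnstile> Imp a (Imp b c) \<Longrightarrow> \<Phi> \<turnstile> Imp b (Imp a c)"
  using MP[OF _ luk_imp_exchange] .

lemma luk_imp_refl: "\<Phi> \<turnstile> Imp a a"
  using MP[OF A1 luk_imp_exchange_rule[OF A1]] .

lemma luk_imp_prefix: "\<Phi> \<turnstile> Imp b c \<Longrightarrow> \<Phi> \<turnstile> Imp (Imp a b) (Imp a c)"
  using MP[OF _ luk_imp_exchange_rule[OF A2]] .

lemma luk_weaken: "\<Phi> \<turnstile> a \<Longrightarrow> \<Phi> \<turnstile> Imp b a"
  using MP[OF _ A1] .

lemma luk_neg_neg_elim: "\<Phi> \<turnstile> Imp (Neg (Neg a)) a"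
  using MP[OF A1 luk_imp_exchange_rule[OF luk_imp_trans[OF luk_imp_trans[OF A1 A4] A4]]] .

lemma luk_neg_neg_intro: "\<Phi> \<turnstile> Imp a (Neg (Neg a))"
  using MP[OF luk_neg_neg_elim A4] .

lemma luk_contrapos: "\<Phi> \<turnstile> Imp (Imp a b) (Imp (Neg b) (Neg a))"
  using luk_imp_trans[OF luk_imp_trans[OF luk_imp_suffix[OF luk_neg_neg_elim]
        luk_imp_prefix[OF luk_neg_neg_intro]] A4] .

lemma luk_contrapos_rule: "\<Phi> \<turnstile> Imp a b \<Longrightarrow> \<Phi> \<turnstile> Imp (Neg b) (Neg a)"
  using MP[OF _ luk_contrapos] .

lemma luk_derives_Odot_iff: "\<Phi> \<turnstile> Odot a b \<longleftrightarrow> \<Phi> \<turnstile> a \<and> \<Phi> \<turnstile> b"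
proof (intro iffI conjI)
  assume ab: "\<Phi> \<turnstile> Odot a b"
  have "\<Phi> \<turnstile> Imp (Odot a b) (Neg (Neg a))"
    unfolding Odot_def Oplus_def
    using luk_contrapos_rule[OF luk_imp_trans[OF A1 luk_contrapos]] .
  then show "\<Phi> \<turnstile> a"
    using ab MP luk_neg_neg_elim by blast
  have "\<Phi> \<turnstile> Imp (Odot a b) (Neg (Neg b))"
    unfolding Odot_def Oplus_def using luk_contrapos_rule[OF A1] .
  then show "\<Phi> \<turnstile> b"
    using ab MP luk_neg_neg_elim by blast
next
  assume ab: "\<Phi> \<turnstile> a \<and> \<Phi> \<turnstile> b"
  have "\<Phi> \<turnstile> Imp (Imp (Neg (Neg a)) (Neg b)) (Neg b)"
    using ab MP luk_imp_assert luk_neg_neg_intro by blast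
  then show "\<Phi> \<turnstile> Odot a b"
    unfolding Odot_def Oplus_def
    using ab MP luk_contrapos_rule luk_neg_neg_intro by blast
qed

lemma lind_rel_iff: "(a, b) \<in> lind_rel \<Phi> \<longleftrightarrow> \<Phi> \<turnstile> Imp a b \<and> \<Phi> \<turnstile> Imp b a"
  by (simp add: lind_rel_def Iff_def luk_derives_Odot_iff)

lemma equiv_lind_rel: "equiv UNIV (lind_rel \<Phi>)"
  by (rule equivI) (auto simp: refl_on_def sym_def trans_def lind_rel_iff
      intro: luk_imp_refl luk_imp_trans)

lemma lind_rel_Neg: "(a, b) \<in> lind_rel \<Phi> \<Longrightarrow> (Neg a, Neg b) \<in> lind_rel \<Phi>"
  by (simp add: lind_rel_iff luk_contrapos_rule)

lemma lind_rel_Imp: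
  assumes "(a, a') \<in> lind_rel \<Phi>" "(b, b') \<in> lind_rel \<Phi>"
  shows "(Imp a b, Imp a' b') \<in> lind_rel \<Phi>"
  using assms unfolding lind_rel_iff
  by (meson luk_imp_trans luk_imp_prefix luk_imp_suffix)

lemma lind_rel_Oplus:
  "(a, a') \<in> lind_rel \<Phi> \<Longrightarrow> (b, b') \<in> lind_rel \<Phi> \<Longrightarrow> (Oplus a b, Oplus a' b') \<in> lind_rel \<Phi>"
  unfolding Oplus_def by (intro lind_rel_Imp lind_rel_Neg)

lemma LIND_class_eq_iff:
  "lind_rel \<Phi> `` {a} = lind_rel \<Phi> `` {b} \<longleftrightarrow> \<Phi> \<turnstile> Imp a b \<and> \<Phi> \<turnstile> Imp b a"
  using eq_equiv_class_iff[OF equiv_lind_rel] lind_rel_iff by blast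

lemma LIND_neg_class:
  "mv_neg (LIND \<Phi>) (lind_rel \<Phi> `` {a}) = lind_rel \<Phi> `` {Neg a}"
proof -
  have "(\<lambda>\<phi>. lind_rel \<Phi> `` {Neg \<phi>}) respects lind_rel \<Phi>"
    by (auto simp: congruent_def LIND_class_eq_iff lind_rel_iff luk_contrapos_rule)
  then show ?thesis
    by (simp add: LIND_def UN_equiv_class[OF equiv_lind_rel])
qed

lemma LIND_plus_class:
  "mv_plus (LIND \<Phi>) (lind_rel \<Phi> `` {a}) (lind_rel \<Phi> `` {b}) = lind_rel \<Phi> `` {Oplus a b}"
proof -
  have "(\<lambda>\<phi> \<psi>. lind_rel \<Phi> `` {Oplus \<phi> \<psi>}) respects2 lind_rel \<Phi>"
    by (auto simp: congruent2_def intro!: equiv_class_eq[OF equiv_lind_rel] lind_rel_Oplus)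
  then show ?thesis
    by (simp add: LIND_def UN_equiv_class2[OF equiv_lind_rel equiv_lind_rel])
qed

lemma LIND_zero_class:
  assumes "\<Phi> \<turnstile> Neg a"
  shows "mv_zero (LIND \<Phi>) = lind_rel \<Phi> `` {a}"
proof -
  have "\<Phi> \<turnstile> Neg b \<longleftrightarrow> (a, b) \<in> lind_rel \<Phi>" for b
    unfolding lind_rel_iff
    by (meson A4 MP assms luk_contrapos_rule luk_weaken)
  then show ?thesis by (auto simp: LIND_def)
qed

lemma mv_algebra_LIND: "mv_algebra (LIND \<Phi>)"
proof -
  obtain p :: "'a luk_form" where "\<Phi> \<turnstile> p" using A1 by blast
  then have n0: "\<Phi> \<turnstile> Neg (Neg p)" using MP luk_neg_neg_intro by blast
  define z where "z = Neg p"
  have z: "\<Phi> \<turnstile> Neg z" using n0 z_def by simp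
  note zero = LIND_zero_class[OF z]
  have swap: "\<Phi> \<turnstile> Imp (Imp (Neg a) b) (Imp (Neg b) a)" for a b
    using luk_imp_trans[OF luk_contrapos luk_imp_prefix[OF luk_neg_neg_elim]] .
  have assoc: "\<Phi> \<turnstile> Imp (Oplus a (Oplus b c)) (Oplus (Oplus a b) c)" for a b c
    unfolding Oplus_def
    by (meson luk_imp_trans luk_imp_prefix luk_imp_exchange swap)
  have assoc': "\<Phi> \<turnstile> Imp (Oplus (Oplus a b) c) (Oplus a (Oplus b c))" for a b c
    unfolding Oplus_def
    by (meson luk_imp_trans luk_imp_prefix luk_imp_exchange swap)
  have zero1: "\<Phi> \<turnstile> Imp (Oplus a z) a" for a
    unfolding Oplus_def using swap MP[OF z luk_imp_exchange_rule] by blast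
  have zero2: "\<Phi> \<turnstile> Imp a (Oplus a z)" for a
    unfolding Oplus_def using luk_imp_trans[OF A1 swap] .
  have one: "\<Phi> \<turnstile> Oplus a (Neg z)" for a
    unfolding Oplus_def using luk_weaken[OF z] .
  have dn: "(Neg (Neg c), c) \<in> lind_rel \<Phi>" for c
    by (simp add: lind_rel_iff luk_neg_neg_elim luk_neg_neg_intro)
  have refl: "(c, c) \<in> lind_rel \<Phi>" for c
    by (simp add: lind_rel_iff luk_imp_refl)
  have luk: "(Oplus (Neg (Oplus (Neg a) b)) b, Imp (Imp a b) b) \<in> lind_rel \<Phi>" for a b
  proof -
    have "(Neg (Neg (Imp (Neg (Neg a)) b)), Imp (Neg (Neg a)) b) \<in> lind_rel \<Phi>"
      by (rule dn)
    moreover have "(Imp (Neg (Neg a)) b, Imp a b) \<in> lind_rel \<Phi>"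
      by (intro lind_rel_Imp dn refl)
    ultimately have "(Neg (Neg (Imp (Neg (Neg a)) b)), Imp a b) \<in> lind_rel \<Phi>"
      using luk_imp_trans unfolding lind_rel_iff by blast
    then show ?thesis
      unfolding Oplus_def by (intro lind_rel_Imp refl)
  qed
  have luk2: "\<Phi> \<turnstile> Imp (Oplus (Neg (Oplus (Neg a) b)) b) (Oplus (Neg (Oplus (Neg b) a)) a)" for a b
    using luk[of a b] luk[of b a] A3[of \<Phi> a b] unfolding lind_rel_iff
    by (meson luk_imp_trans)
  have car: "x \<in> mv_carrier (LIND \<Phi>) \<longleftrightarrow> (\<exists>a. x = lind_rel \<Phi> `` {a})" for x
    by (auto simp: LIND_def quotient_def)
  show ?thesis
  proof (standard, unfold car zero)
  qed ((elim exE)?, simp only: LIND_neg_class LIND_plus_class LIND_class_eq_iff,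
      blast intro: luk_imp_refl assoc assoc' zero1 zero2 luk2 luk_neg_neg_elim luk_neg_neg_intro
        luk_weaken[OF one] luk_weaken[OF z] swap[folded Oplus_def])+
qed


section \<open>Semantics\<close>

definition unit_cube :: "(real ^ 'n) set" where
  "unit_cube = {v. \<forall>i. 0 \<le> v $ i \<and> v $ i \<le> 1}"

primrec luk_eval :: "'n luk_form \<Rightarrow> real ^ 'n \<Rightarrow> real" where
  "luk_eval (Var i) v = v $ i"
| "luk_eval (Neg \<phi>) v = 1 - luk_eval \<phi> v"
| "luk_eval (Imp \<phi> \<psi>) v = min 1 (1 - luk_eval \<phi> v + luk_eval \<psi> v)"

lemma luk_eval_Oplus: "luk_eval (Oplus \<phi> \<psi>) v = min 1 (luk_eval \<phi> v + luk_eval \<psi> v)"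
  by (simp add: Oplus_def)

lemma luk_eval_range: "v \<in> unit_cube \<Longrightarrow> luk_eval \<phi> v \<in> {0..1}"
  by (induction \<phi>) (auto simp: unit_cube_def)

definition Mod :: "'n luk_form set \<Rightarrow> (real ^ 'n) set" where
  "Mod \<Theta> = {v \<in> unit_cube. \<forall>\<theta>\<in>\<Theta>. luk_eval \<theta> v = 1}"

definition Th :: "(real ^ 'n) set \<Rightarrow> 'n luk_form set" where
  "Th X = {\<psi>. \<forall>w\<in>X. luk_eval \<psi> w = 1}"


section \<open>Bouligand--Severi tangents\<close>

definition rational_point :: "real ^ 'n \<Rightarrow> bool" where
  "rational_point x \<longleftrightarrow> (\<forall>i. x $ i \<in> \<rat>)"

definition rational_vector :: "real ^ 'n \<Rightarrow> bool" where
  "rational_vector w \<longleftrightarrow> w \<noteq> 0 \<and> (\<exists>c. c *\<^sub>R w \<noteq> 0 \<and> rational_point (c *\<^sub>R w))"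

definition bouligand_severi_tangent :: "(real ^ 'n) set \<Rightarrow> real ^ 'n \<Rightarrow> real ^ 'n \<Rightarrow> bool" where
  "bouligand_severi_tangent X x u \<longleftrightarrow>
     closed X \<and> x \<in> X \<and> norm u = 1 \<and>
     (\<exists>s :: nat \<Rightarrow> real ^ 'n.
        (\<forall>i. s i \<in> X - {x}) \<and> s \<longlonglongrightarrow> x \<and>
        (\<lambda>i. (s i - x) /\<^sub>R norm (s i - x)) \<longlonglongrightarrow> u)"

definition outgoing :: "(real ^ 'n) set \<Rightarrow> real ^ 'n \<Rightarrow> real ^ 'n \<Rightarrow> bool" where
  "outgoing X x u \<longleftrightarrow>
     (\<exists>\<mu>>0. rel_interior (convex hull {x, x + \<mu> *\<^sub>R u}) \<inter> X = {})"

lemma continuous_on_luk_eval: "continuous_on S (luk_eval \<phi>)"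
  by (induction \<phi>) (auto intro!: continuous_intros)

lemma closed_Mod: "closed (Mod \<Theta>)"
proof -
  have "Mod \<Theta> = (\<Inter>i. {v. 0 \<le> v $ i} \<inter> {v. v $ i \<le> 1}) \<inter> (\<Inter>\<theta>\<in>\<Theta>. {v. luk_eval \<theta> v = 1})"
    by (auto simp: Mod_def unit_cube_def)
  moreover have "closed \<dots>"
    by (intro closed_Int closed_INT ballI closed_Collect_le closed_Collect_eq
        continuous_on_luk_eval continuous_intros)
  ultimately show ?thesis by simp
qed

end

theory Submission
  imports Defs
begin

text \<open>By soundness \<open>Th X\<close> is deductively closed, so for \<open>X = Mod \<Theta>\<close> the algebra \<open>LIND (Th X)\<close> is the
  algebra of truth functions restricted to \<open>X\<close>. The functions vanishing at a point of \<open>X\<close> form a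
  maximal ideal, which gives semisimplicity; by compactness of \<open>X\<close> every proper ideal is contained in
  such a point ideal. Given a rational outgoing tangent \<open>u\<close> at a rational \<open>v\<close>, there is a truth function
  \<open>f\<close> whose zero set is a short segment from \<open>v\<close> in direction \<open>u\<close>, hence meets \<open>X\<close> only in \<open>v\<close>, and a
  truth function \<open>g\<close> vanishing at \<open>v\<close> with positive slope in direction \<open>u\<close>. Modulo \<open>f\<close> the only point
  ideal left is that of \<open>v\<close>, so \<open>g\<close> lies in every maximal ideal. But along a sequence in \<open>X\<close>
  approaching \<open>v\<close> in direction \<open>u\<close>, \<open>f\<close> is of smaller order than \<open>g\<close>, so \<open>g\<close> is not in the ideal
  generated by \<open>f\<close>.\<close>

section \<open>The Lindenbaum algebra of a theory of points\<close>

definition Monus :: "'n luk_form \<Rightarrow> 'n luk_form \<Rightarrow> 'n luk_form" where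
  "Monus \<phi> \<psi> = Neg (Oplus (Neg \<phi>) \<psi>)"

definition Dist :: "'n luk_form \<Rightarrow> 'n luk_form \<Rightarrow> 'n luk_form" where
  "Dist \<phi> \<psi> = Oplus (Monus \<phi> \<psi>) (Monus \<psi> \<phi>)"

text \<open>A refutable formula in place of a constant for falsum. Which variable is chosen does not
  matter: \<open>Imp\<close> of a formula to itself has value 1 everywhere.\<close>

definition Bot :: "'n luk_form" where
  "Bot = Neg (Imp (Var undefined) (Var undefined))"

lemma luk_eval_Bot [simp]: "luk_eval Bot w = 0"
  by (simp add: Bot_def)

lemma luk_eval_Odot: "luk_eval (Odot \<phi> \<psi>) w = max 0 (luk_eval \<phi> w + luk_eval \<psi> w - 1)"
  by (simp add: Odot_def luk_eval_Oplus)

lemma luk_eval_Monus: "luk_eval (Monus \<phi> \<psi>) w = max 0 (luk_eval \<phi> w - luk_eval \<psi> w)"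
  by (simp add: Monus_def luk_eval_Oplus)

lemma luk_eval_Dist:
  "w \<in> unit_cube \<Longrightarrow> luk_eval (Dist \<phi> \<psi>) w = \<bar>luk_eval \<phi> w - luk_eval \<psi> w\<bar>"
  using luk_eval_range[of w \<phi>] luk_eval_range[of w \<psi>]
  by (auto simp: Dist_def luk_eval_Oplus luk_eval_Monus)

lemma luk_eval_nonneg: "w \<in> unit_cube \<Longrightarrow> 0 \<le> luk_eval \<phi> w"
  and luk_eval_le_one: "w \<in> unit_cube \<Longrightarrow> luk_eval \<phi> w \<le> 1"
  using luk_eval_range[of w \<phi>] by auto

lemma luk_derives_sound:
  assumes "\<Phi> \<turnstile> \<phi>" and "w \<in> unit_cube" and "\<And>\<theta>. \<theta> \<in> \<Phi> \<Longrightarrow> luk_eval \<theta> w = 1"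
  shows "luk_eval \<phi> w = 1"
  using assms(1)
proof (induction rule: luk_derives.induct)
  case (Hyp \<phi>)
  then show ?case by (rule assms(3))
next
  case (A1 \<alpha> \<beta>)
  show ?case using luk_eval_range[OF assms(2), of \<beta>] luk_eval_range[OF assms(2), of \<alpha>] by auto
next
  case (A2 \<alpha> \<beta> \<gamma>)
  show ?case by (auto simp: min_def)
next
  case (A3 \<alpha> \<beta>)
  show ?case using luk_eval_range[OF assms(2), of \<beta>] luk_eval_range[OF assms(2), of \<alpha>]
    by (auto simp: min_def)
next
  case (A4 \<alpha> \<beta>)
  show ?case by (auto simp: min_def)
next
  case (MP \<alpha> \<beta>)
  then show ?case using luk_eval_le_one[OF assms(2), of \<beta>] by (simp add: min_def split: if_splits)
qed

lemma compact_unit_cube: "compact (unit_cube :: (real ^ 'n::finite) set)"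
proof -
  have "unit_cube = cbox (0 :: real ^ 'n) 1"
    by (auto simp: unit_cube_def mem_box_cart)
  then show ?thesis using compact_cbox by metis
qed

lemma compact_Mod: "compact (Mod \<Theta> :: (real ^ 'n::finite) set)"
proof -
  have "Mod \<Theta> = unit_cube \<inter> Mod \<Theta>" by (auto simp: Mod_def)
  then show ?thesis using compact_Int_closed[OF compact_unit_cube closed_Mod] by metis
qed

locale cube_subset =
  fixes X :: "(real ^ 'n::finite) set"
  assumes subset_cube: "X \<subseteq> unit_cube"
begin

abbreviation A :: "'n luk_form set mv_structure" where
  "A \<equiv> LIND (Th X)"

definition cl :: "'n luk_form \<Rightarrow> 'n luk_form set" where
  "cl \<phi> = lind_rel (Th X) `` {\<phi>}"

lemma nonneg: "w \<in> X \<Longrightarrow> 0 \<le> luk_eval \<phi> w"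
  and le_one: "w \<in> X \<Longrightarrow> luk_eval \<phi> w \<le> 1"
  using subset_cube luk_eval_nonneg luk_eval_le_one by blast+

text \<open>Soundness gives one direction; conversely, a formula with value 1 on all of
  \<open>X\<close> is itself a hypothesis. Questions about \<open>A\<close> thereby become questions
  about truth functions restricted to \<open>X\<close>.\<close>

lemma derives_Th_iff: "Th X \<turnstile> \<phi> \<longleftrightarrow> (\<forall>w\<in>X. luk_eval \<phi> w = 1)"
proof
  assume "Th X \<turnstile> \<phi>"
  then show "\<forall>w\<in>X. luk_eval \<phi> w = 1"
    using luk_derives_sound subset_cube by (fastforce simp: Th_def)
next
  assume "\<forall>w\<in>X. luk_eval \<phi> w = 1"
  then show "Th X \<turnstile> \<phi>" by (intro luk_derives.Hyp) (simp add: Th_def)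
qed

lemma cl_eq_iff: "cl \<phi> = cl \<psi> \<longleftrightarrow> (\<forall>w\<in>X. luk_eval \<phi> w = luk_eval \<psi> w)"
  unfolding cl_def LIND_class_eq_iff derives_Th_iff by force

lemma carrier_A: "mv_carrier A = range cl"
  by (auto simp: LIND_def quotient_def cl_def)

lemma cl_in_carrier [simp]: "cl \<phi> \<in> mv_carrier A"
  by (simp add: carrier_A)

lemma zero_A: "mv_zero A = cl Bot"
  unfolding cl_def by (rule LIND_zero_class) (simp add: derives_Th_iff)

lemma neg_cl: "mv_neg A (cl \<phi>) = cl (Neg \<phi>)"
  by (simp add: cl_def LIND_neg_class)

lemma plus_cl: "mv_plus A (cl \<phi>) (cl \<psi>) = cl (Oplus \<phi> \<psi>)"
  by (simp add: cl_def LIND_plus_class)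

lemma le_cl_iff: "mv_le A (cl \<phi>) (cl \<psi>) \<longleftrightarrow> (\<forall>w\<in>X. luk_eval \<phi> w \<le> luk_eval \<psi> w)"
  unfolding mv_le_def zero_A neg_cl plus_cl cl_eq_iff luk_eval_Oplus by force

lemma dist_cl: "mv_dist A (cl \<phi>) (cl \<psi>) = cl (Dist \<phi> \<psi>)"
  by (simp add: mv_dist_def mv_minus_def neg_cl plus_cl Dist_def Monus_def)

lemma eval_Dist: "w \<in> X \<Longrightarrow> luk_eval (Dist \<phi> \<psi>) w = \<bar>luk_eval \<phi> w - luk_eval \<psi> w\<bar>"
  using subset_cube luk_eval_Dist by blast


subsection \<open>Ideals as sets of formulas\<close>

lemma mv_ideal_iff:
  "mv_ideal A I \<longleftrightarrow> I \<subseteq> range cl \<and> cl Bot \<in> I \<and>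
     (\<forall>\<phi> \<psi>. cl \<phi> \<in> I \<longrightarrow> cl \<psi> \<in> I \<longrightarrow> cl (Oplus \<phi> \<psi>) \<in> I) \<and>
     (\<forall>\<phi> \<psi>. cl \<phi> \<in> I \<longrightarrow> (\<forall>w\<in>X. luk_eval \<psi> w \<le> luk_eval \<phi> w) \<longrightarrow> cl \<psi> \<in> I)"
proof (cases "I \<subseteq> range cl")
  case True
  then have "(\<forall>x\<in>I. P x) \<longleftrightarrow> (\<forall>\<phi>. cl \<phi> \<in> I \<longrightarrow> P (cl \<phi>))" for P by blast
  then show ?thesis
    using True by (simp add: mv_ideal_def carrier_A zero_A plus_cl le_cl_iff)
qed (simp add: mv_ideal_def carrier_A)

lemma ideal_Bot: "mv_ideal A I \<Longrightarrow> cl Bot \<in> I"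
  and ideal_Oplus: "mv_ideal A I \<Longrightarrow> cl \<phi> \<in> I \<Longrightarrow> cl \<psi> \<in> I \<Longrightarrow> cl (Oplus \<phi> \<psi>) \<in> I"
  and ideal_mono: "mv_ideal A I \<Longrightarrow> cl \<phi> \<in> I \<Longrightarrow> (\<And>w. w \<in> X \<Longrightarrow> luk_eval \<psi> w \<le> luk_eval \<phi> w)
    \<Longrightarrow> cl \<psi> \<in> I"
  unfolding mv_ideal_iff by blast+

text \<open>Formulas with the same truth function on \<open>X\<close> bound each other, so
  \<open>mono\<close> makes \<open>P\<close> independent of the representative of a class.\<close>

lemma ideal_of_predicate:
  assumes "P Bot"
    and "\<And>\<phi> \<psi>. P \<phi> \<Longrightarrow> P \<psi> \<Longrightarrow> P (Oplus \<phi> \<psi>)"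
    and mono: "\<And>\<phi> \<psi>. P \<phi> \<Longrightarrow> (\<And>w. w \<in> X \<Longrightarrow> luk_eval \<psi> w \<le> luk_eval \<phi> w) \<Longrightarrow> P \<psi>"
  shows "mv_ideal A {cl \<phi> |\<phi>. P \<phi>}" and "cl \<phi> \<in> {cl \<phi> |\<phi>. P \<phi>} \<longleftrightarrow> P \<phi>"
proof -
  have mem: "cl \<phi> \<in> {cl \<phi> |\<phi>. P \<phi>} \<longleftrightarrow> P \<phi>" for \<phi>
    using mono by (auto simp: cl_eq_iff)
  show "mv_ideal A {cl \<phi> |\<phi>. P \<phi>}"
    unfolding mv_ideal_iff mem using assms by blast
  show "cl \<phi> \<in> {cl \<phi> |\<phi>. P \<phi>} \<longleftrightarrow> P \<phi>" by (rule mem)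
qed

lemma ideal_eq_carrier: "mv_ideal A I \<Longrightarrow> cl (Neg Bot) \<in> I \<Longrightarrow> I = mv_carrier A"
  using ideal_mono[of I "Neg Bot"] le_one by (auto simp: mv_ideal_def carrier_A)

lemma ideal_principal: "mv_ideal A (mv_principal_ideal A a)" if "a \<in> mv_carrier A"
proof -
  have "mv_ideal A (mv_carrier A)" by (simp add: mv_ideal_iff carrier_A)
  then show ?thesis
    using that unfolding mv_principal_ideal_def mv_ideal_def by blast
qed

text \<open>The witness is the \<open>n\<close>-fold truncated sum of \<phi> with itself; a large
  \<open>n\<close> pushes positive values up to 1.\<close>

lemma ideal_multiple:
  assumes I: "mv_ideal A I" and "cl \<phi> \<in> I"
  shows "\<exists>\<psi>. cl \<psi> \<in> I \<and> (\<forall>w\<in>X. luk_eval \<psi> w = min 1 (real n * luk_eval \<phi> w))"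
proof (induction n)
  case 0
  show ?case using ideal_Bot[OF I] by (intro exI[of _ Bot]) simp
next
  case (Suc n)
  then obtain \<psi> where \<psi>: "cl \<psi> \<in> I" "\<forall>w\<in>X. luk_eval \<psi> w = min 1 (real n * luk_eval \<phi> w)"
    by blast
  have "luk_eval (Oplus \<phi> \<psi>) w = min 1 (real (Suc n) * luk_eval \<phi> w)" if "w \<in> X" for w
    using that \<psi>(2) nonneg[OF that, of \<phi>] by (auto simp: luk_eval_Oplus algebra_simps)
  then show ?case using ideal_Oplus[OF I assms(2) \<psi>(1)] by blast
qed

text \<open>By the Archimedean property some truncated multiple of \<phi> is constantly 1 on
  \<open>X\<close>, which puts the top element into \<open>I\<close>.\<close>

lemma ideal_proper_bound:
  assumes I: "mv_ideal A I" "I \<noteq> mv_carrier A" and \<phi>: "cl \<phi> \<in> I"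
    and "\<epsilon> > 0" and "\<And>w. w \<in> X \<Longrightarrow> \<epsilon> \<le> luk_eval \<phi> w"
  shows False
proof -
  obtain n :: nat where n: "1 / \<epsilon> < real n" using reals_Archimedean2 by blast
  obtain \<psi> where \<psi>: "cl \<psi> \<in> I" "\<forall>w\<in>X. luk_eval \<psi> w = min 1 (real n * luk_eval \<phi> w)"
    using ideal_multiple[OF I(1) \<phi>] by blast
  have "luk_eval \<psi> w = 1" if "w \<in> X" for w
  proof -
    have "1 \<le> real n * \<epsilon>" using n \<open>\<epsilon> > 0\<close> by (simp add: field_simps)
    also have "\<dots> \<le> real n * luk_eval \<phi> w" using assms(5)[OF that] by (simp add: mult_left_mono)
    finally show ?thesis using \<psi>(2) that by simp
  qed
  then have "cl (Neg Bot) \<in> I" by (intro ideal_mono[OF I(1) \<psi>(1)]) simp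
  then show False using ideal_eq_carrier I by blast
qed

section \<open>Point ideals and semisimplicity\<close>

definition point_ideal :: "real ^ 'n \<Rightarrow> 'n luk_form set set" where
  "point_ideal x = {cl \<phi> |\<phi>. luk_eval \<phi> x = 0}"

lemma
  assumes x: "x \<in> X"
  shows ideal_point_ideal: "mv_ideal A (point_ideal x)"
    and cl_in_point_ideal_iff: "cl \<phi> \<in> point_ideal x \<longleftrightarrow> luk_eval \<phi> x = 0"
proof -
  have "luk_eval \<psi> x = 0" if "luk_eval \<phi> x = 0" "\<And>w. w \<in> X \<Longrightarrow> luk_eval \<psi> w \<le> luk_eval \<phi> w" for \<phi> \<psi>
    using that(1) that(2)[OF x] nonneg[OF x, of \<psi>] by simp
  note * = ideal_of_predicate[of "\<lambda>\<phi>. luk_eval \<phi> x = 0", OF _ _ this, folded point_ideal_def]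
  show "mv_ideal A (point_ideal x)" by (rule *(1)) (auto simp: luk_eval_Oplus)
  show "cl \<phi> \<in> point_ideal x \<longleftrightarrow> luk_eval \<phi> x = 0" by (rule *(2)) (auto simp: luk_eval_Oplus)
qed

text \<open>A larger ideal \<open>J\<close> contains some \<psi> positive at \<open>x\<close>, hence
  a multiple \<rho> with value 1 at \<open>x\<close>. Then \<open>Neg \<rho>\<close> vanishes at
  \<open>x\<close> and also lies in \<open>J\<close>, and the sum of the two is the top
  element.\<close>

lemma maximal_point_ideal:
  assumes x: "x \<in> X"
  shows "mv_maximal_ideal A (point_ideal x)"
  unfolding mv_maximal_ideal_def
proof (intro conjI allI impI)
  show "mv_ideal A (point_ideal x)" by (rule ideal_point_ideal[OF x])
  have "cl (Neg Bot) \<notin> point_ideal x" by (simp add: cl_in_point_ideal_iff[OF x])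
  then show "point_ideal x \<noteq> mv_carrier A" using cl_in_carrier by blast
next
  fix J assume J: "mv_ideal A J" "point_ideal x \<subseteq> J"
  show "J = point_ideal x \<or> J = mv_carrier A"
  proof (cases "J = point_ideal x")
    case False
    then obtain \<psi> where \<psi>: "cl \<psi> \<in> J" "cl \<psi> \<notin> point_ideal x"
      using J unfolding mv_ideal_iff by blast
    then have pos: "luk_eval \<psi> x > 0"
      using nonneg[OF x, of \<psi>] by (simp add: cl_in_point_ideal_iff[OF x] less_le)
    obtain n :: nat where "1 / luk_eval \<psi> x < real n" using reals_Archimedean2 by blast
    then have n: "1 \<le> real n * luk_eval \<psi> x" using pos by (simp add: field_simps)
    obtain \<rho> where \<rho>: "cl \<rho> \<in> J" "\<forall>w\<in>X. luk_eval \<rho> w = min 1 (real n * luk_eval \<psi> w)"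
      using ideal_multiple[OF J(1) \<psi>(1)] by blast
    have "luk_eval (Neg \<rho>) x = 0" using \<rho>(2) x n by simp
    then have "cl (Neg \<rho>) \<in> J" using J(2) cl_in_point_ideal_iff[OF x] by blast
    then have "cl (Oplus \<rho> (Neg \<rho>)) \<in> J" using ideal_Oplus[OF J(1)] \<rho>(1) by blast
    then have "cl (Neg Bot) \<in> J" by (rule ideal_mono[OF J(1)]) (simp add: luk_eval_Oplus)
    then show ?thesis using ideal_eq_carrier J(1) by blast
  qed simp
qed

lemma semisimple_A: "mv_semisimple A"
  unfolding mv_semisimple_def
proof (intro equalityI subsetI)
  fix y assume y: "y \<in> mv_carrier A \<inter> \<Inter>{M. mv_maximal_ideal A M}"
  then obtain \<phi> where \<phi>: "y = cl \<phi>" by (auto simp: carrier_A)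
  have "luk_eval \<phi> x = 0" if "x \<in> X" for x
    using y maximal_point_ideal[OF that] cl_in_point_ideal_iff[OF that] \<phi> by blast
  then show "y \<in> {mv_zero A}" by (simp add: \<phi> zero_A cl_eq_iff)
next
  fix y assume "y \<in> {mv_zero A}"
  then show "y \<in> mv_carrier A \<inter> \<Inter>{M. mv_maximal_ideal A M}"
    by (auto simp: mv_maximal_ideal_def mv_ideal_def zero_A)
qed

text \<open>Compactness reduces the claim to finitely many members of \<open>M\<close>. Their
  truncated sum lies in \<open>M\<close> and bounds them all; its minimum on \<open>X\<close> must
  be 0, since \<open>M\<close> is proper, and they all vanish where it is attained.\<close>

lemma proper_ideal_common_zero:
  assumes "compact X" and M: "mv_ideal A M" "M \<noteq> mv_carrier A"
  shows "\<exists>x\<in>X. M \<subseteq> point_ideal x"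
proof -
  have "X \<inter> (\<Inter>\<phi>\<in>{\<phi>. cl \<phi> \<in> M}. {w. luk_eval \<phi> w = 0}) \<noteq> {}"
  proof (rule compact_imp_fip_image[OF \<open>compact X\<close>])
    show "closed {w. luk_eval \<phi> w = 0}" for \<phi> :: "'n luk_form"
      by (intro closed_Collect_eq continuous_on_luk_eval continuous_intros)
  next
    fix F assume F: "finite F" "F \<subseteq> {\<phi>. cl \<phi> \<in> M}"
    have "\<exists>\<psi>. cl \<psi> \<in> M \<and> (\<forall>w\<in>X. \<forall>\<phi>\<in>F. luk_eval \<phi> w \<le> luk_eval \<psi> w)"
      using F
    proof (induction rule: finite_induct)
      case empty
      then show ?case using ideal_Bot[OF M(1)] by blast
    next
      case (insert \<rho> F)
      then obtain \<psi> where \<psi>: "cl \<psi> \<in> M" "\<forall>w\<in>X. \<forall>\<phi>\<in>F. luk_eval \<phi> w \<le> luk_eval \<psi> w"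
        by auto
      have "cl (Oplus \<rho> \<psi>) \<in> M" using ideal_Oplus[OF M(1)] \<psi>(1) insert.prems by blast
      moreover have "luk_eval \<phi> w \<le> luk_eval (Oplus \<rho> \<psi>) w"
        if "w \<in> X" "\<phi> \<in> insert \<rho> F" for w \<phi>
        using that \<psi>(2) nonneg[OF that(1), of \<psi>] nonneg[OF that(1), of \<rho>] le_one[OF that(1), of \<phi>]
        by (fastforce simp: luk_eval_Oplus)
      ultimately show ?case by blast
    qed
    then obtain \<psi> where \<psi>: "cl \<psi> \<in> M" "\<forall>w\<in>X. \<forall>\<phi>\<in>F. luk_eval \<phi> w \<le> luk_eval \<psi> w" by blast
    \<comment> \<open>On an empty \<open>X\<close> the lower bound 1 would hold vacuously, against
      properness of \<open>M\<close>.\<close>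
    have "X \<noteq> {}" using ideal_proper_bound[OF M \<psi>(1), of 1] by auto
    then obtain y where y: "y \<in> X" "\<And>w. w \<in> X \<Longrightarrow> luk_eval \<psi> y \<le> luk_eval \<psi> w"
      using continuous_attains_inf[OF \<open>compact X\<close> _ continuous_on_luk_eval] by blast
    then have "luk_eval \<psi> y = 0"
      using ideal_proper_bound[OF M \<psi>(1), of "luk_eval \<psi> y"] nonneg[OF y(1), of \<psi>]
      by (cases "luk_eval \<psi> y = 0") auto
    then have "\<forall>\<phi>\<in>F. luk_eval \<phi> y = 0" using \<psi>(2) y(1) nonneg[OF y(1)] by (metis antisym)
    then show "X \<inter> (\<Inter>\<phi>\<in>F. {w. luk_eval \<phi> w = 0}) \<noteq> {}" using y(1) by blast
  qed
  then obtain x where "x \<in> X" "\<And>\<phi>. cl \<phi> \<in> M \<Longrightarrow> luk_eval \<phi> x = 0" by blast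
  moreover have "M \<subseteq> range cl" using M(1) by (simp add: mv_ideal_iff)
  ultimately have "M \<subseteq> point_ideal x" using cl_in_point_ideal_iff by blast
  then show ?thesis using \<open>x \<in> X\<close> by blast
qed


subsection \<open>Quotients\<close>

definition qc :: "'n luk_form set set \<Rightarrow> 'n luk_form \<Rightarrow> 'n luk_form set set" where
  "qc I \<phi> = mv_cong A I `` {cl \<phi>}"

context
  fixes I assumes I: "mv_ideal A I"
begin

lemma cong_cl_iff: "(cl \<phi>, cl \<psi>) \<in> mv_cong A I \<longleftrightarrow> cl (Dist \<phi> \<psi>) \<in> I"
  by (simp add: mv_cong_def dist_cl)

lemma cong_cases:
  assumes "(x, y) \<in> mv_cong A I"
  obtains \<phi> \<psi> where "x = cl \<phi>" "y = cl \<psi>" "cl (Dist \<phi> \<psi>) \<in> I"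
  using assms by (auto simp: mv_cong_def carrier_A dist_cl)

lemma equiv_cong: "equiv (mv_carrier A) (mv_cong A I)"
proof (rule equivI)
  show "mv_cong A I \<subseteq> mv_carrier A \<times> mv_carrier A" by (auto simp: mv_cong_def)
  have "cl (Dist \<phi> \<phi>) \<in> I" for \<phi>
    by (rule ideal_mono[OF I ideal_Bot[OF I]]) (simp add: eval_Dist)
  then show "refl_on (mv_carrier A) (mv_cong A I)"
    by (auto simp: refl_on_def carrier_A cong_cl_iff)
  have "cl (Dist \<psi> \<phi>) \<in> I" if "cl (Dist \<phi> \<psi>) \<in> I" for \<phi> \<psi>
    by (rule ideal_mono[OF I that]) (simp add: eval_Dist)
  then show "sym (mv_cong A I)"
    by (auto simp: sym_def mv_cong_def carrier_A dist_cl)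
  \<comment> \<open>The triangle inequality for absolute differences; the bound by 1 covers the case
    in which the sum is truncated.\<close>
  have "cl (Dist \<phi> \<rho>) \<in> I" if "cl (Dist \<phi> \<psi>) \<in> I" "cl (Dist \<psi> \<rho>) \<in> I" for \<phi> \<psi> \<rho>
    using le_one[of _ "Dist \<phi> \<rho>"]
    by (intro ideal_mono[OF I ideal_Oplus[OF I that]]) (auto simp: eval_Dist luk_eval_Oplus)
  then show "trans (mv_cong A I)"
    unfolding trans_def mv_cong_def carrier_A by (auto simp: dist_cl)
qed

lemma qc_eq_iff: "qc I \<phi> = qc I \<psi> \<longleftrightarrow> cl (Dist \<phi> \<psi>) \<in> I"
  unfolding qc_def eq_equiv_class_iff[OF equiv_cong cl_in_carrier cl_in_carrier] cong_cl_iff ..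

lemma carrier_quotient: "mv_carrier (mv_quotient A I) = range (qc I)"
  by (auto simp: mv_quotient_def quotient_def carrier_A qc_def)

lemma zero_quotient: "mv_zero (mv_quotient A I) = qc I Bot"
  by (simp add: mv_quotient_def zero_A qc_def)

lemma neg_qc: "mv_neg (mv_quotient A I) (qc I \<phi>) = qc I (Neg \<phi>)"
proof -
  have "cl (Dist (Neg \<phi>) (Neg \<psi>)) \<in> I" if "cl (Dist \<phi> \<psi>) \<in> I" for \<phi> \<psi>
    by (rule ideal_mono[OF I that]) (simp add: eval_Dist)
  then have "(\<lambda>x. mv_cong A I `` {mv_neg A x}) respects mv_cong A I"
    by (intro congruentI, elim cong_cases) (simp add: neg_cl qc_eq_iff flip: qc_def)
  then show ?thesis
    by (simp add: mv_quotient_def qc_def UN_equiv_class[OF equiv_cong] neg_cl)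
qed

lemma plus_qc: "mv_plus (mv_quotient A I) (qc I \<phi>) (qc I \<psi>) = qc I (Oplus \<phi> \<psi>)"
proof -
  \<comment> \<open>Truncated addition is nonexpansive, so the distance of two sums is at most the
    sum of the distances.\<close>
  have "cl (Dist (Oplus \<phi> \<psi>) (Oplus \<phi>' \<psi>')) \<in> I"
    if "cl (Dist \<phi> \<phi>') \<in> I" "cl (Dist \<psi> \<psi>') \<in> I" for \<phi> \<psi> \<phi>' \<psi>'
  proof (rule ideal_mono[OF I ideal_Oplus[OF I that]])
    fix w assume w: "w \<in> X"
    show "luk_eval (Dist (Oplus \<phi> \<psi>) (Oplus \<phi>' \<psi>')) w
        \<le> luk_eval (Oplus (Dist \<phi> \<phi>') (Dist \<psi> \<psi>')) w"
      using nonneg[OF w, of \<phi>] nonneg[OF w, of \<psi>] nonneg[OF w, of \<phi>'] nonneg[OF w, of \<psi>']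
      unfolding luk_eval_Oplus eval_Dist[OF w] by linarith
  qed
  then have "(\<lambda>x y. mv_cong A I `` {mv_plus A x y}) respects2 mv_cong A I"
    by (intro congruent2I', elim cong_cases) (simp add: plus_cl qc_eq_iff flip: qc_def)
  then show ?thesis
    by (simp add: mv_quotient_def qc_def UN_equiv_class2[OF equiv_cong equiv_cong] plus_cl)
qed

lemma le_qc_iff: "mv_le (mv_quotient A I) (qc I \<phi>) (qc I \<psi>) \<longleftrightarrow> cl (Monus \<phi> \<psi>) \<in> I"
proof -
  \<comment> \<open>The amount by which \<open>Oplus (Neg \<phi>) \<psi>\<close> falls short of 1 is
    the positive part of the difference of the values.\<close>
  have "cl (Dist (Oplus (Neg \<phi>) \<psi>) (Neg Bot)) = cl (Monus \<phi> \<psi>)"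
    by (auto simp: cl_eq_iff eval_Dist luk_eval_Oplus luk_eval_Monus)
  then show ?thesis
    by (simp add: mv_le_def zero_quotient neg_qc plus_qc qc_eq_iff)
qed

lemma mv_ideal_quotient_iff:
  "mv_ideal (mv_quotient A I) N \<longleftrightarrow> N \<subseteq> range (qc I) \<and> qc I Bot \<in> N \<and>
     (\<forall>\<phi> \<psi>. qc I \<phi> \<in> N \<longrightarrow> qc I \<psi> \<in> N \<longrightarrow> qc I (Oplus \<phi> \<psi>) \<in> N) \<and>
     (\<forall>\<phi> \<psi>. qc I \<phi> \<in> N \<longrightarrow> cl (Monus \<psi> \<phi>) \<in> I \<longrightarrow> qc I \<psi> \<in> N)"
proof (cases "N \<subseteq> range (qc I)")
  case True
  then have "(\<forall>x\<in>N. P x) \<longleftrightarrow> (\<forall>\<phi>. qc I \<phi> \<in> N \<longrightarrow> P (qc I \<phi>))" for P by blast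
  then show ?thesis
    using True by (simp add: mv_ideal_def carrier_quotient zero_quotient plus_qc le_qc_iff)
qed (simp add: mv_ideal_def carrier_quotient)

section \<open>Maximal ideals of quotients and failure of strong semisimplicity\<close>

text \<open>Pulling \<open>N\<close> back along the quotient map gives a proper ideal
  \<open>M\<close> of \<open>A\<close> that contains \<open>I\<close>, hence \<open>f\<close>. A
  common zero of \<open>M\<close> in \<open>X\<close> must then be \<open>v\<close>. The classes of
  formulas vanishing there form a proper ideal \<open>K\<close> above \<open>N\<close>, so
  \<open>K = N\<close> by maximality.\<close>

lemma maximal_ideal_quotient_mem:
  assumes "compact X" and N: "mv_maximal_ideal (mv_quotient A I) N"
    and f: "cl f \<in> I" and f_zero: "\<And>x. x \<in> X \<Longrightarrow> luk_eval f x = 0 \<Longrightarrow> x = v"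
    and g: "luk_eval g v = 0"
  shows "qc I g \<in> N"
proof -
  have "mv_ideal (mv_quotient A I) N" using N by (simp add: mv_maximal_ideal_def)
  then have N': "N \<subseteq> range (qc I)" "qc I Bot \<in> N"
    "\<And>\<phi> \<psi>. qc I \<phi> \<in> N \<Longrightarrow> qc I \<psi> \<in> N \<Longrightarrow> qc I (Oplus \<phi> \<psi>) \<in> N"
    "\<And>\<phi> \<psi>. qc I \<phi> \<in> N \<Longrightarrow> cl (Monus \<psi> \<phi>) \<in> I \<Longrightarrow> qc I \<psi> \<in> N"
    unfolding mv_ideal_quotient_iff by blast+
  have mono: "qc I \<psi> \<in> N"
    if "qc I \<phi> \<in> N" "\<And>w. w \<in> X \<Longrightarrow> luk_eval \<psi> w \<le> luk_eval \<phi> w" for \<phi> \<psi>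
  proof (rule N'(4)[OF that(1)])
    show "cl (Monus \<psi> \<phi>) \<in> I"
      by (rule ideal_mono[OF I ideal_Bot[OF I]]) (simp add: luk_eval_Monus that(2))
  qed
  define M where "M = {cl \<phi> |\<phi>. qc I \<phi> \<in> N}"
  have M: "mv_ideal A M" and mem_M: "cl \<phi> \<in> M \<longleftrightarrow> qc I \<phi> \<in> N" for \<phi>
    unfolding M_def
    using ideal_of_predicate[of "\<lambda>\<phi>. qc I \<phi> \<in> N", OF N'(2) N'(3) mono] by simp_all
  \<comment> \<open>Members of \<open>I\<close> are below zero in the quotient, so the pullback
    contains them.\<close>
  have IM: "cl \<phi> \<in> M" if "cl \<phi> \<in> I" for \<phi>
  proof -
    have "cl (Monus \<phi> Bot) \<in> I"
      by (rule ideal_mono[OF I that]) (simp add: luk_eval_Monus nonneg)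
    then show ?thesis unfolding mem_M by (rule N'(4)[OF N'(2)])
  qed
  have "M \<noteq> mv_carrier A"
  proof
    assume "M = mv_carrier A"
    then have "range (qc I) \<subseteq> N" using mem_M cl_in_carrier by blast
    then have "N = mv_carrier (mv_quotient A I)" using N'(1) carrier_quotient by blast
    then show False using N by (simp add: mv_maximal_ideal_def)
  qed
  then obtain x where x: "x \<in> X" "M \<subseteq> point_ideal x"
    using proper_ideal_common_zero[OF \<open>compact X\<close> M] by blast
  have zero: "luk_eval \<phi> x = 0" if "cl \<phi> \<in> M" for \<phi>
    using x that cl_in_point_ideal_iff by blast
  have "x = v" using f_zero x(1) zero[OF IM[OF f]] by blast
  define K where "K = {qc I \<phi> |\<phi>. luk_eval \<phi> x = 0}"
  \<comment> \<open>Members of \<open>I\<close> vanish at \<open>x\<close>, so formulas equivalent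
    modulo \<open>I\<close> agree there and \<open>K\<close> does not depend on
    representatives.\<close>
  have mem_K: "qc I \<phi> \<in> K \<longleftrightarrow> luk_eval \<phi> x = 0" for \<phi>
  proof
    assume "qc I \<phi> \<in> K"
    then obtain \<psi> where "qc I \<phi> = qc I \<psi>" and \<psi>: "luk_eval \<psi> x = 0" unfolding K_def by blast
    then have "luk_eval (Dist \<phi> \<psi>) x = 0" using zero IM qc_eq_iff by blast
    then show "luk_eval \<phi> x = 0" using \<psi> x(1) by (simp add: eval_Dist)
  qed (auto simp: K_def)
  have "luk_eval \<psi> x = 0" if "luk_eval \<phi> x = 0" "cl (Monus \<psi> \<phi>) \<in> I" for \<phi> \<psi>
    using that(1) zero[OF IM[OF that(2)]] nonneg[OF x(1), of \<psi>] by (simp add: luk_eval_Monus)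
  then have "mv_ideal (mv_quotient A I) K"
    unfolding mv_ideal_quotient_iff mem_K by (auto simp: luk_eval_Oplus K_def)
  moreover have "N \<subseteq> K"
    using N'(1) zero mem_M mem_K by blast
  moreover have "qc I (Neg Bot) \<notin> K" by (simp add: mem_K)
  then have "K \<noteq> mv_carrier (mv_quotient A I)" using carrier_quotient by blast
  ultimately have "K = N" using N unfolding mv_maximal_ideal_def by blast
  then show ?thesis using mem_K g \<open>x = v\<close> by blast
qed

end

text \<open>Here \<open>r\<close> is a rate, later the distance of \<open>s i\<close> from
  \<open>v\<close>. The formulas of order o(\<open>r i\<close>) at \<open>s i\<close> give an ideal
  that contains \<open>f\<close> but not \<open>g\<close>, so \<open>g\<close> is nonzero modulo
  \<open>f\<close> although its class lies in every maximal ideal.\<close>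

lemma not_strongly_semisimple:
  assumes "compact X" and f_zero: "\<And>x. x \<in> X \<Longrightarrow> luk_eval f x = 0 \<Longrightarrow> x = v"
    and g: "luk_eval g v = 0"
    and s: "\<And>i. s i \<in> X" and r: "\<And>i. r i > 0"
    and f_lim: "(\<lambda>i. luk_eval f (s i) / r i) \<longlonglongrightarrow> 0"
    and g_lim: "\<not> (\<lambda>i. luk_eval g (s i) / r i) \<longlonglongrightarrow> 0"
  shows "\<not> mv_strongly_semisimple A"
proof
  assume "mv_strongly_semisimple A"
  define I where "I = mv_principal_ideal A (cl f)"
  have I: "mv_ideal A I" unfolding I_def by (rule ideal_principal) simp
  have fI: "cl f \<in> I" by (simp add: I_def mv_principal_ideal_def)
  let ?P = "\<lambda>\<phi>. (\<lambda>i. luk_eval \<phi> (s i) / r i) \<longlonglongrightarrow> 0"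
  have Bot: "?P Bot" by simp
  have Oplus: "?P (Oplus \<phi> \<psi>)" if "?P \<phi>" "?P \<psi>" for \<phi> \<psi>
  proof (rule tendsto_sandwich[where f = "\<lambda>_. 0"])
    show "(\<lambda>i. luk_eval \<phi> (s i) / r i + luk_eval \<psi> (s i) / r i) \<longlonglongrightarrow> 0"
      using tendsto_add[OF that] by simp
    show "\<forall>\<^sub>F i in sequentially. 0 \<le> luk_eval (Oplus \<phi> \<psi>) (s i) / r i"
      using nonneg[OF s] r by (simp add: less_imp_le)
    show "\<forall>\<^sub>F i in sequentially. luk_eval (Oplus \<phi> \<psi>) (s i) / r i
        \<le> luk_eval \<phi> (s i) / r i + luk_eval \<psi> (s i) / r i"
      using r by (simp add: luk_eval_Oplus less_imp_le divide_right_mono flip: add_divide_distrib)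
  qed simp
  have mono: "?P \<psi>" if "?P \<phi>" "\<And>w. w \<in> X \<Longrightarrow> luk_eval \<psi> w \<le> luk_eval \<phi> w" for \<phi> \<psi>
  proof (rule tendsto_sandwich[where f = "\<lambda>_. 0"])
    show "?P \<phi>" by (rule that)
    show "\<forall>\<^sub>F i in sequentially. 0 \<le> luk_eval \<psi> (s i) / r i"
      using nonneg[OF s] r by (simp add: less_imp_le)
    show "\<forall>\<^sub>F i in sequentially. luk_eval \<psi> (s i) / r i \<le> luk_eval \<phi> (s i) / r i"
      using that(2)[OF s] r by (simp add: less_imp_le divide_right_mono)
  qed simp
  have J: "mv_ideal A {cl \<phi> |\<phi>. ?P \<phi>}" and mem_J: "cl \<phi> \<in> {cl \<phi> |\<phi>. ?P \<phi>} \<longleftrightarrow> ?P \<phi>" for \<phi>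
    by (rule ideal_of_predicate[of ?P]; fact Bot Oplus mono)+
  have "I \<subseteq> {cl \<phi> |\<phi>. ?P \<phi>}"
    unfolding I_def mv_principal_ideal_def using J f_lim by blast
  then have "cl g \<notin> I" using mem_J[of g] g_lim by blast
  have "mv_semisimple (mv_quotient A I)"
    using \<open>mv_strongly_semisimple A\<close> by (simp add: mv_strongly_semisimple_def I_def)
  moreover have "qc I g \<in> N" if "mv_maximal_ideal (mv_quotient A I) N" for N
    by (rule maximal_ideal_quotient_mem[OF I \<open>compact X\<close> that fI f_zero g])
  ultimately have "qc I g = qc I Bot"
    by (auto simp: mv_semisimple_def carrier_quotient[OF I] zero_quotient[OF I])
  then have "cl (Dist g Bot) \<in> I" using qc_eq_iff[OF I] by blast
  then have "cl g \<in> I" by (rule ideal_mono[OF I]) (simp add: eval_Dist)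
  with \<open>cl g \<notin> I\<close> show False by blast
qed

end



section \<open>Truncated affine functions\<close>

definition trunc :: "real \<Rightarrow> real" where
  "trunc x = max 0 (min 1 x)"

lemma trunc_eq_0_iff: "trunc x = 0 \<longleftrightarrow> x \<le> 0"
  by (auto simp: trunc_def)

text \<open>The identity behind McNaughton's theorem: the right side is built by
  \<open>Oplus\<close> and \<open>Odot\<close> from \<open>y\<close> and truncations of
  \<open>x\<close> and \<open>x + 1\<close>, so a variable can be added to an affine
  function.\<close>

lemma trunc_add_unit:
  "0 \<le> y \<Longrightarrow> y \<le> 1 \<Longrightarrow> trunc (x + y) = max 0 (min 1 (trunc x + y) + trunc (x + 1) - 1)"
  unfolding trunc_def by linarith

lemma trunc_one_minus: "trunc (1 - x) = 1 - trunc x"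
  unfolding trunc_def by linarith

text \<open>All integer constants are treated at once because induction shifts them: for the
  constant \<open>c\<close>, adding a variable calls for \<open>c\<close> and \<open>c + 1\<close>,
  negation for \<open>1 - c\<close>.\<close>

definition trunc_definable :: "(real ^ 'n \<Rightarrow> real) \<Rightarrow> bool" where
  "trunc_definable p \<longleftrightarrow>
     (\<forall>c::int. \<exists>\<phi>. \<forall>w\<in>unit_cube. luk_eval \<phi> w = trunc (p w + of_int c))"

lemma trunc_definable_0: "trunc_definable (\<lambda>_. 0)"
  unfolding trunc_definable_def
proof
  fix c :: int
  show "\<exists>\<phi>::'a luk_form. \<forall>w\<in>unit_cube. luk_eval \<phi> w = trunc (0 + of_int c)"
  proof (cases "c \<le> 0")
    case True
    then show ?thesis by (intro exI[of _ Bot]) (simp add: trunc_def)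
  next
    case False
    then show ?thesis by (intro exI[of _ "Neg Bot"]) (simp add: trunc_def)
  qed
qed

lemma trunc_definable_uminus:
  assumes "trunc_definable p"
  shows "trunc_definable (\<lambda>w. - p w)"
  unfolding trunc_definable_def
proof
  fix c :: int
  obtain \<phi> where \<phi>: "\<forall>w\<in>unit_cube. luk_eval \<phi> w = trunc (p w + of_int (1 - c))"
    using assms unfolding trunc_definable_def by blast
  have "luk_eval (Neg \<phi>) w = trunc (- p w + of_int c)" if "w \<in> unit_cube" for w
    using \<phi> that trunc_one_minus[of "p w + of_int (1 - c)"] by (simp add: algebra_simps)
  then show "\<exists>\<phi>. \<forall>w\<in>unit_cube. luk_eval \<phi> w = trunc (- p w + of_int c)" by blast
qed

lemma trunc_definable_add_nth:
  assumes "trunc_definable p"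
  shows "trunc_definable (\<lambda>w. p w + w $ i)"
  unfolding trunc_definable_def
proof
  fix c :: int
  obtain \<phi> \<psi> where \<phi>: "\<forall>w\<in>unit_cube. luk_eval \<phi> w = trunc (p w + of_int c)"
    and \<psi>: "\<forall>w\<in>unit_cube. luk_eval \<psi> w = trunc (p w + of_int (c + 1))"
    using assms unfolding trunc_definable_def by blast
  have "luk_eval (Odot (Oplus \<phi> (Var i)) \<psi>) w = trunc (p w + w $ i + of_int c)"
    if "w \<in> unit_cube" for w
    using \<phi> \<psi> that trunc_add_unit[of "w $ i" "p w + of_int c"]
    by (simp add: luk_eval_Odot luk_eval_Oplus unit_cube_def algebra_simps)
  then show "\<exists>\<phi>. \<forall>w\<in>unit_cube. luk_eval \<phi> w = trunc (p w + w $ i + of_int c)" by blast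
qed

lemma trunc_definable_add_nat_mult_nth:
  assumes "trunc_definable p"
  shows "trunc_definable (\<lambda>w. p w + real m * w $ i)"
proof (induction m)
  case 0
  then show ?case using assms by simp
next
  case (Suc m)
  from trunc_definable_add_nth[OF this, of i] show ?case by (simp add: algebra_simps)
qed

lemma trunc_definable_add_int_mult_nth:
  assumes "trunc_definable p"
  shows "trunc_definable (\<lambda>w. p w + of_int a * w $ i)"
proof (cases "a \<ge> 0")
  case True
  then show ?thesis using trunc_definable_add_nat_mult_nth[OF assms, of "nat a" i] by simp
next
  case False
  \<comment> \<open>For a negative coefficient, negate \<open>p\<close>, add the positive multiple
    and negate back.\<close>
  then show ?thesis
    using trunc_definable_uminus[OF trunc_definable_add_nat_mult_nth
        [OF trunc_definable_uminus[OF assms], of "nat (- a)" i]]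
    by (simp add: add.commute)
qed

lemma trunc_definable_sum:
  fixes a :: "'n::finite \<Rightarrow> int"
  shows "trunc_definable (\<lambda>w. \<Sum>i\<in>UNIV. of_int (a i) * w $ i)"
proof -
  have "trunc_definable (\<lambda>w. \<Sum>i\<in>F. of_int (a i) * w $ i)" if "finite F" for F
    using that
  proof (induction F)
    case empty
    show ?case by (simp add: trunc_definable_0)
  next
    case (insert i F)
    then show ?case
      using trunc_definable_add_int_mult_nth[OF insert.IH, of "a i" i] by (simp add: add.commute)
  qed
  then show ?thesis by simp
qed

text \<open>Integrality of every \<open>a $ i * v $ i\<close> makes the constant term
  \<open>c - a \<bullet> v\<close> an integer, so this function centred at \<open>v\<close> has
  integer coefficients.\<close>

lemma trunc_affine_formula:
  fixes a v :: "real ^ 'n::finite"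
  assumes "\<And>i. a $ i \<in> \<int>" and "\<And>i. a $ i * v $ i \<in> \<int>" and "c \<in> \<int>"
  shows "\<exists>\<phi>. \<forall>w\<in>unit_cube. luk_eval \<phi> w = trunc (a \<bullet> (w - v) + c)"
proof -
  have "c - a \<bullet> v \<in> \<int>" using assms by (auto simp: inner_vec_def intro!: Ints_diff Ints_sum)
  then obtain c' where c': "c - a \<bullet> v = of_int c'" by (auto elim: Ints_cases)
  have a: "of_int \<lfloor>a $ i\<rfloor> = a $ i" for i using assms(1) by simp
  obtain \<phi> where "\<forall>w\<in>unit_cube. luk_eval \<phi> w = trunc ((\<Sum>i\<in>UNIV. of_int \<lfloor>a $ i\<rfloor> * w $ i) + of_int c')"
    using trunc_definable_sum[of "\<lambda>i. \<lfloor>a $ i\<rfloor>"] unfolding trunc_definable_def by blast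
  moreover have "(\<Sum>i\<in>UNIV. of_int \<lfloor>a $ i\<rfloor> * w $ i) + of_int c' = a \<bullet> (w - v) + c" for w
    using c' unfolding a by (simp add: inner_diff_right) (simp add: inner_vec_def)
  ultimately show ?thesis by auto
qed

text \<open>Serves to conjoin zero conditions: values on the cube are nonnegative, so the truncated
  sum vanishes exactly at the common zeros of \<open>F\<close>.\<close>

lemma finite_Oplus_formula:
  assumes "finite F"
  shows "\<exists>\<phi>. \<forall>w\<in>unit_cube. luk_eval \<phi> w = min 1 (\<Sum>\<psi>\<in>F. luk_eval \<psi> w)"
  using assms
proof (induction F)
  case empty
  show ?case by (intro exI[of _ Bot]) simp
next
  case (insert \<rho> F)
  then obtain \<phi> where \<phi>: "\<forall>w\<in>unit_cube. luk_eval \<phi> w = min 1 (\<Sum>\<psi>\<in>F. luk_eval \<psi> w)" by blast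
  have "luk_eval (Oplus \<rho> \<phi>) w = min 1 (\<Sum>\<psi>\<in>insert \<rho> F. luk_eval \<psi> w)" if "w \<in> unit_cube" for w
    using \<phi> that luk_eval_nonneg[OF that, of \<rho>] insert.hyps by (auto simp: luk_eval_Oplus)
  then show ?case by blast
qed


section \<open>Rational outgoing tangents\<close>

lemma rational_point_common_denominator:
  fixes x :: "real ^ 'n::finite"
  assumes "rational_point x"
  obtains d :: nat where "d > 0" and "\<And>i. real d * x $ i \<in> \<int>"
proof -
  have "\<exists>d::nat. d > 0 \<and> real d * x $ i \<in> \<int>" for i
  proof -
    have "x $ i \<in> \<rat>" using assms by (simp add: rational_point_def)
    then obtain a b :: int where "b > 0" "x $ i = of_int a / of_int b" by (rule Rats_cases')
    then show ?thesis by (intro exI[of _ "nat b"]) simp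
  qed
  then obtain d :: "'n \<Rightarrow> nat" where d: "\<And>i. d i > 0" "\<And>i. real (d i) * x $ i \<in> \<int>" by metis
  show thesis
  proof
    show "prod d UNIV > 0" using d(1) by (simp add: prod_pos)
    fix i
    have "real (prod d UNIV) * x $ i = real (prod d (UNIV - {i})) * (real (d i) * x $ i)"
      by (simp add: prod.remove[of UNIV i d] flip: of_nat_prod)
    also have "\<dots> \<in> \<int>" by (rule Ints_mult[OF Ints_of_nat d(2)])
    finally show "real (prod d UNIV) * x $ i \<in> \<int>" .
  qed
qed

text \<open>The given scalar \<open>c\<close> may be negative; taking its absolute value keeps the
  direction of \<open>u\<close> and only affects signs of integral coordinates.\<close>

lemma rational_vector_integer_multiple:
  fixes u :: "real ^ 'n::finite"
  assumes "rational_vector u"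
  obtains q where "q > 0" and "\<And>i. (q *\<^sub>R u) $ i \<in> \<int>"
proof -
  obtain c where c: "c *\<^sub>R u \<noteq> 0" "rational_point (c *\<^sub>R u)"
    using assms by (auto simp: rational_vector_def)
  obtain d :: nat where d: "d > 0" "\<And>i. real d * (c *\<^sub>R u) $ i \<in> \<int>"
    using rational_point_common_denominator[OF c(2)] by blast
  have "(\<bar>real d * c\<bar> *\<^sub>R u) $ i \<in> \<int>" for i
    using d(2)[of i] by (auto simp: abs_if mult.assoc)
  moreover have "\<bar>real d * c\<bar> > 0" using c(1) d(1) by simp
  ultimately show thesis using that by blast
qed

text \<open>\<open>trunc (p i)\<close> is squeezed between 0 and the positive part of
  \<open>p i\<close>, whose quotient by \<open>r i\<close> tends to
  \<open>max 0 l = 0\<close>.\<close>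

lemma trunc_tendsto_0:
  fixes p r :: "nat \<Rightarrow> real"
  assumes lim: "(\<lambda>i. p i / r i) \<longlonglongrightarrow> l" and "l \<le> 0" and r: "\<And>i. r i > 0"
  shows "(\<lambda>i. trunc (p i) / r i) \<longlonglongrightarrow> 0"
proof (rule tendsto_sandwich[where f = "\<lambda>_. 0"])
  show "(\<lambda>i. max 0 (p i / r i)) \<longlonglongrightarrow> 0"
    using tendsto_max[OF tendsto_const[of 0] lim] \<open>l \<le> 0\<close> by (simp add: max_absorb1)
  show "\<forall>\<^sub>F i in sequentially. 0 \<le> trunc (p i) / r i"
    using r by (simp add: trunc_def less_imp_le)
  have "trunc (p i) / r i \<le> max 0 (p i) / r i" for i
    using r[of i] by (intro divide_right_mono) (auto simp: trunc_def)
  moreover have "max 0 (p i) / r i = max 0 (p i / r i)" for i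
    using r[of i] by (auto simp: max_def field_simps)
  ultimately show "\<forall>\<^sub>F i in sequentially. trunc (p i) / r i \<le> max 0 (p i / r i)" by simp
qed simp

text \<open>The formulas \<open>f\<close> and \<open>g\<close> come from integral affine functions: with \<open>w\<close> an integral positive
  multiple of \<open>u\<close> and \<open>w\<^sub>k \<noteq> 0\<close>, the equations \<open>(x - v)\<^sub>i w\<^sub>k = (x - v)\<^sub>k w\<^sub>i\<close> cut out the line \<open>v + \<real>w\<close>,
  and \<open>0 \<le> D w\<^sub>k (x - v)\<^sub>k \<le> 1\<close> with \<open>D\<close> large cuts that down to a short segment starting at \<open>v\<close>.\<close>

lemma rational_outgoing_tangent_formulas:
  fixes X :: "(real ^ 'n::finite) set"
  assumes cube: "X \<subseteq> unit_cube" and "v \<in> X" and v: "rational_point v" and u: "rational_vector u"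
    and out: "outgoing X v u"
    and s: "\<And>i. s i \<in> X - {v}" and s_lim: "s \<longlonglongrightarrow> v"
    and dir: "(\<lambda>i. (s i - v) /\<^sub>R norm (s i - v)) \<longlonglongrightarrow> u"
  obtains f g where "\<And>x. x \<in> X \<Longrightarrow> luk_eval f x = 0 \<Longrightarrow> x = v" and "luk_eval g v = 0"
    and "(\<lambda>i. luk_eval f (s i) / norm (s i - v)) \<longlonglongrightarrow> 0"
    and "\<not> (\<lambda>i. luk_eval g (s i) / norm (s i - v)) \<longlonglongrightarrow> 0"
proof -
  obtain \<mu> where \<mu>: "\<mu> > 0" "rel_interior (convex hull {v, v + \<mu> *\<^sub>R u}) \<inter> X = {}"
    using out by (auto simp: outgoing_def)
  have "u \<noteq> 0" using u by (simp add: rational_vector_def)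
  obtain q where q: "q > 0" "\<And>i. (q *\<^sub>R u) $ i \<in> \<int>"
    using rational_vector_integer_multiple[OF u] by blast
  define w where "w = q *\<^sub>R u"
  have w_Ints: "w $ i \<in> \<int>" for i using q(2) by (simp add: w_def)
  have "w \<noteq> 0" using q(1) \<open>u \<noteq> 0\<close> by (simp add: w_def)
  then obtain k where k: "w $ k \<noteq> 0" by (auto simp: vec_eq_iff)
  have wk: "(w $ k)\<^sup>2 \<ge> 1"
  proof -
    obtain m where m: "w $ k = of_int m" using w_Ints Ints_cases by blast
    then have "1 \<le> m\<^sup>2" using k zero_less_power2[of m] by (simp add: int_one_le_iff_zero_less)
    then have "1 \<le> real_of_int (m\<^sup>2)" by linarith
    then show ?thesis using m by simp
  qed
  obtain d :: nat where d: "d > 0" "\<And>i. real d * v $ i \<in> \<int>"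
    using rational_point_common_denominator[OF v] by blast
  \<comment> \<open>\<open>D\<close> is a multiple of the common denominator \<open>d\<close> of
    \<open>v\<close>, which makes the constant terms integral, and exceeds \<open>q / \<mu>\<close>,
    which makes the segment end before \<open>v + \<mu> *\<^sub>R u\<close>.\<close>
  obtain n :: nat where n: "q / \<mu> < real n" using reals_Archimedean2 by blast
  define D where "D = real (d * n)"
  have "0 < q / \<mu>" using q(1) \<mu>(1) by simp
  have "D \<ge> real n" using mult_right_mono[of 1 "real d" "real n"] d(1) by (simp add: D_def)
  then have D: "q / \<mu> < D" "D > 0" using n \<open>0 < q / \<mu>\<close> by linarith+
  have D_Ints: "D \<in> \<int>" by (simp add: D_def)
  have Dv: "D * v $ i \<in> \<int>" for i
  proof -
    have "D * v $ i = real n * (real d * v $ i)" by (simp add: D_def)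
    then show ?thesis using d(2)[of i] Ints_mult Ints_of_nat by metis
  qed
  have D_Ints_formula: "\<exists>\<phi>. \<forall>x\<in>unit_cube. luk_eval \<phi> x = trunc ((D *\<^sub>R b) \<bullet> (x - v) + c)"
    if "\<And>i. b $ i \<in> \<int>" "c \<in> \<int>" for b c
  proof (rule trunc_affine_formula)
    fix i
    show "(D *\<^sub>R b) $ i \<in> \<int>" using that(1) D_Ints by simp
    have "(D *\<^sub>R b) $ i * v $ i = b $ i * (D * v $ i)" by simp
    then show "(D *\<^sub>R b) $ i * v $ i \<in> \<int>" using that(1) Dv Ints_mult by metis
  qed (rule that(2))
  \<comment> \<open>At \<open>v + \<tau> *\<^sub>R w\<close> the value of \<open>L\<close> is
    \<open>D * (w $ k)\<^sup>2 * \<tau>\<close>, so \<open>L\<close> increases along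
    \<open>u\<close> whatever the sign of \<open>w $ k\<close>.\<close>
  define L where "L x = D * w $ k * (x - v) $ k" for x
  define E where "E i x = D * (w $ k * (x - v) $ i - w $ i * (x - v) $ k)" for i x
  have inner_axis_sc: "(D *\<^sub>R (a *\<^sub>R axis i 1)) \<bullet> x = D * a * x $ i" for a i and x :: "real ^ 'n"
    by (simp add: inner_axis')
  have L_formula: "\<exists>\<phi>. \<forall>x\<in>unit_cube. luk_eval \<phi> x = trunc (\<epsilon> * L x + c)"
    if "\<epsilon> \<in> {1, -1}" "c \<in> \<int>" for \<epsilon> c
  proof -
    have "((\<epsilon> * w $ k) *\<^sub>R axis k 1 :: real ^ 'n) $ i \<in> \<int>" for i
      using that(1) w_Ints by (auto simp: axis_def)
    from D_Ints_formula[OF this that(2)] show ?thesis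
      unfolding inner_axis_sc L_def by (simp add: algebra_simps)
  qed
  have E_formula: "\<exists>\<phi>. \<forall>x\<in>unit_cube. luk_eval \<phi> x = trunc (\<epsilon> * E i x)" if "\<epsilon> \<in> {1, -1}" for \<epsilon> i
  proof -
    have "((\<epsilon> * w $ k) *\<^sub>R axis i 1 - (\<epsilon> * w $ i) *\<^sub>R axis k 1 :: real ^ 'n) $ j \<in> \<int>" for j
      using that w_Ints by (auto simp: axis_def)
    from D_Ints_formula[OF this Ints_0] show ?thesis
      unfolding scaleR_diff_right inner_diff_left inner_axis_sc E_def
      by (simp add: algebra_simps)
  qed
  obtain g where g: "\<And>x. x \<in> unit_cube \<Longrightarrow> luk_eval g x = trunc (L x)"
    using L_formula[of 1 0] by auto
  obtain h where h: "\<And>x. x \<in> unit_cube \<Longrightarrow> luk_eval h x = trunc (- L x)"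
    using L_formula[of "-1" 0] by auto
  obtain t where t: "\<And>x. x \<in> unit_cube \<Longrightarrow> luk_eval t x = trunc (L x - 1)"
    using L_formula[of 1 "-1"] by auto
  obtain e where e: "\<And>i x. x \<in> unit_cube \<Longrightarrow> luk_eval (e i) x = trunc (E i x)"
    using E_formula[of 1] by simp metis
  obtain e' where e': "\<And>i x. x \<in> unit_cube \<Longrightarrow> luk_eval (e' i) x = trunc (- E i x)"
    using E_formula[of "-1"] by simp metis
  \<comment> \<open>As \<open>trunc y\<close> vanishes iff \<open>y \<le> 0\<close>, the formulas
    \<open>h\<close> and \<open>t\<close> encode \<open>0 \<le> L x\<close> and
    \<open>L x \<le> 1\<close>, and each equation \<open>E i x = 0\<close> takes the pair
    \<open>e i\<close>, \<open>e' i\<close>.\<close>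
  define F where "F = {h, t} \<union> range e \<union> range e'"
  have "finite F" by (simp add: F_def)
  then obtain f where f: "\<And>x. x \<in> unit_cube \<Longrightarrow> luk_eval f x = min 1 (\<Sum>\<psi>\<in>F. luk_eval \<psi> x)"
    using finite_Oplus_formula by blast
  define r where "r i = norm (s i - v)" for i
  have r: "r i > 0" for i using s by (simp add: r_def)
  have s_cube: "s i \<in> unit_cube" for i using s cube by blast
  have dir_nth: "(\<lambda>i. (s i - v) $ j / r i) \<longlonglongrightarrow> u $ j" for j
    using tendsto_vec_nth[OF dir, of j] by (simp add: r_def divide_inverse mult.commute)
  have L_dir: "(\<lambda>i. L (s i) / r i) \<longlonglongrightarrow> D * w $ k * u $ k"
    using tendsto_mult_left[OF dir_nth, of "D * w $ k" k] by (simp add: L_def mult.assoc)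
  \<comment> \<open>The first-order terms cancel because \<open>w\<close> is parallel to
    \<open>u\<close>.\<close>
  have E_dir: "(\<lambda>i. E j (s i) / r i) \<longlonglongrightarrow> 0" for j
  proof -
    have "(\<lambda>i. D * (w $ k * ((s i - v) $ j / r i) - w $ j * ((s i - v) $ k / r i)))
        \<longlonglongrightarrow> D * (w $ k * u $ j - w $ j * u $ k)"
      by (intro tendsto_intros dir_nth)
    moreover have "w $ k * u $ j - w $ j * u $ k = 0" by (simp add: w_def)
    moreover have "E j (s i) / r i
        = D * (w $ k * ((s i - v) $ j / r i) - w $ j * ((s i - v) $ k / r i))" for i
      by (simp add: E_def diff_divide_distrib right_diff_distrib)
    ultimately show ?thesis by simp
  qed
  have slope: "D * w $ k * u $ k > 0"
  proof -
    have "u $ k = w $ k / q" using q(1) by (simp add: w_def)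
    then have "D * w $ k * u $ k = D * (w $ k)\<^sup>2 / q" by (simp add: power2_eq_square)
    then show ?thesis using D(2) q(1) k by simp
  qed
  have L_lim: "(\<lambda>i. L (s i)) \<longlonglongrightarrow> 0"
  proof -
    have "(\<lambda>i. D * w $ k * (s i - v) $ k) \<longlonglongrightarrow> D * w $ k * (v - v) $ k"
      by (intro tendsto_intros s_lim)
    then show ?thesis by (simp add: L_def)
  qed
  \<comment> \<open>Close to \<open>v\<close> the far end of the segment is not felt:
    \<open>t\<close> is 0 at \<open>s i\<close>, and truncation at 1 leaves \<open>L\<close>
    unchanged.\<close>
  then have L_small: "\<forall>\<^sub>F i in sequentially. L (s i) < 1" by (rule order_tendstoD) simp
  show thesis
  proof
    fix x assume x: "x \<in> X" and "luk_eval f x = 0"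
    have x_cube: "x \<in> unit_cube" using x cube by blast
    then have "(\<Sum>\<psi>\<in>F. luk_eval \<psi> x) = 0" using f \<open>luk_eval f x = 0\<close> by (simp add: min_def split: if_splits)
    then have F0: "luk_eval \<psi> x = 0" if "\<psi> \<in> F" for \<psi>
      using that \<open>finite F\<close> luk_eval_nonneg[OF x_cube] by (simp add: sum_nonneg_eq_0_iff)
    have L0: "0 \<le> L x" using F0[of h] h[OF x_cube] by (simp add: F_def trunc_eq_0_iff)
    have L1: "L x \<le> 1" using F0[of t] t[OF x_cube] by (simp add: F_def trunc_eq_0_iff)
    have E0: "E i x = 0" for i
      using F0[of "e i"] F0[of "e' i"] e[OF x_cube, of i] e'[OF x_cube, of i]
      by (simp add: F_def trunc_eq_0_iff)
    define \<tau> where "\<tau> = (x - v) $ k / w $ k"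
    have x_eq: "x = v + \<tau> *\<^sub>R w"
    proof -
      have "w $ k * (x - v) $ i = w $ i * (x - v) $ k" for i
        using E0[of i] D(2) by (simp add: E_def)
      then have "(x - v) $ i = \<tau> * w $ i" for i
        using k by (simp add: \<tau>_def field_simps)
      then have "x - v = \<tau> *\<^sub>R w" by (simp add: vec_eq_iff)
      then show ?thesis by (simp add: algebra_simps)
    qed
    have L_\<tau>: "L x = D * (w $ k)\<^sup>2 * \<tau>"
      using k by (simp add: L_def \<tau>_def power2_eq_square)
    show "x = v"
    proof (rule ccontr)
      assume "x \<noteq> v"
      then have "\<tau> \<noteq> 0" using x_eq by auto
      moreover have "\<tau> \<ge> 0" using L0 D(2) wk unfolding L_\<tau>
        by (smt (verit) mult_pos_pos mult_pos_neg)
      ultimately have "\<tau> > 0" by simp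
      \<comment> \<open>The bound \<open>wk\<close> removes the square; with
        \<open>L x \<le> 1\<close> and the choice of \<open>D\<close>, this places \<open>x\<close>
        strictly before the end of the outgoing segment.\<close>
      have "D * \<tau> \<le> D * (w $ k)\<^sup>2 * \<tau>"
        using mult_left_mono[OF wk, of "D * \<tau>"] D(2) \<open>\<tau> > 0\<close> by (simp add: mult_ac)
      then have "D * \<tau> \<le> 1" using L1 L_\<tau> by simp
      moreover have "q / \<mu> * \<tau> < D * \<tau>" using D(1) \<open>\<tau> > 0\<close> by (rule mult_strict_right_mono)
      ultimately have small: "\<tau> * q / \<mu> < 1" by (simp add: mult.commute)
      \<comment> \<open>Since \<open>w\<close> is \<open>q *\<^sub>R u\<close>, the displacement
        \<open>\<tau> *\<^sub>R w\<close> is the fraction \<open>\<tau> * q / \<mu>\<close> of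
        \<open>\<mu> *\<^sub>R u\<close>.\<close>
      have "x = (1 - \<tau> * q / \<mu>) *\<^sub>R v + (\<tau> * q / \<mu>) *\<^sub>R (v + \<mu> *\<^sub>R u)"
        using \<mu>(1) unfolding x_eq w_def by (simp add: algebra_simps)
      moreover have "v \<noteq> v + \<mu> *\<^sub>R u" using \<mu>(1) \<open>u \<noteq> 0\<close> by simp
      moreover have "0 < \<tau> * q / \<mu>" using \<open>\<tau> > 0\<close> q(1) \<mu>(1) by simp
      ultimately have "x \<in> open_segment v (v + \<mu> *\<^sub>R u)"
        using small unfolding in_segment by blast
      then have "x \<in> rel_interior (convex hull {v, v + \<mu> *\<^sub>R u})"
        using \<open>v \<noteq> v + \<mu> *\<^sub>R u\<close>
        by (simp only: segment_convex_hull[symmetric] rel_interior_closed_segment if_False)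
      then show False using \<mu>(2) x by blast
    qed
  next
    have "v \<in> unit_cube" using \<open>v \<in> X\<close> cube by blast
    then show "luk_eval g v = 0" by (simp add: g L_def trunc_eq_0_iff)
  next
    have F_lim: "(\<lambda>i. luk_eval \<psi> (s i) / r i) \<longlonglongrightarrow> 0" if "\<psi> \<in> F" for \<psi>
    proof -
      \<comment> \<open>\<open>- L\<close> has a negative rate, so its truncation has rate 0;
        \<open>t\<close> is eventually 0, and the \<open>E j\<close> have rate 0 themselves.\<close>
      have "(\<lambda>i. luk_eval h (s i) / r i) \<longlonglongrightarrow> 0"
        unfolding h[OF s_cube]
        by (rule trunc_tendsto_0[of _ _ "- (D * w $ k * u $ k)"])
          (use tendsto_minus[OF L_dir] slope r in auto)
      moreover have "(\<lambda>i. luk_eval t (s i) / r i) \<longlonglongrightarrow> 0"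
        unfolding t[OF s_cube]
        by (rule tendsto_eventually) (use L_small in eventually_elim, simp add: trunc_def)
      moreover have "(\<lambda>i. luk_eval (e j) (s i) / r i) \<longlonglongrightarrow> 0" for j
        unfolding e[OF s_cube] by (rule trunc_tendsto_0[OF E_dir _ r]) simp
      moreover have "(\<lambda>i. luk_eval (e' j) (s i) / r i) \<longlonglongrightarrow> 0" for j
        unfolding e'[OF s_cube]
        by (rule trunc_tendsto_0[of _ _ 0]) (use tendsto_minus[OF E_dir[of j]] r in auto)
      ultimately show ?thesis using that by (auto simp: F_def)
    qed
    have "(\<lambda>i. luk_eval f (s i) / r i) \<longlonglongrightarrow> 0"
    proof (rule tendsto_sandwich[where f = "\<lambda>_. 0"])
      show "(\<lambda>i. \<Sum>\<psi>\<in>F. luk_eval \<psi> (s i) / r i) \<longlonglongrightarrow> 0"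
        using tendsto_sum[of F, OF F_lim] by simp
      show "\<forall>\<^sub>F i in sequentially. 0 \<le> luk_eval f (s i) / r i"
        using luk_eval_nonneg[OF s_cube] r by (simp add: less_imp_le)
      show "\<forall>\<^sub>F i in sequentially. luk_eval f (s i) / r i \<le> (\<Sum>\<psi>\<in>F. luk_eval \<psi> (s i) / r i)"
        using r by (simp add: f[OF s_cube] less_imp_le divide_right_mono flip: sum_divide_distrib)
    qed simp
    then show "(\<lambda>i. luk_eval f (s i) / norm (s i - v)) \<longlonglongrightarrow> 0" by (simp add: r_def)
  next
    have "\<forall>\<^sub>F i in sequentially. L (s i) / r i > 0"
      using order_tendstoD(1)[OF L_dir slope] .
    \<comment> \<open>Eventually \<open>0 < L (s i) < 1\<close>, so \<open>g\<close> equals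
      \<open>L\<close> there and inherits its positive slope.\<close>
    then have "\<forall>\<^sub>F i in sequentially. luk_eval g (s i) / r i = L (s i) / r i"
      using L_small
    proof eventually_elim
      case (elim i)
      then have "0 < L (s i)" using r[of i] by (simp add: zero_less_divide_iff)
      then show ?case using elim(2) by (simp add: g[OF s_cube] trunc_def)
    qed
    then have "(\<lambda>i. luk_eval g (s i) / r i) \<longlonglongrightarrow> D * w $ k * u $ k"
      using L_dir tendsto_cong by fast
    then show "\<not> (\<lambda>i. luk_eval g (s i) / norm (s i - v)) \<longlonglongrightarrow> 0"
      using slope LIMSEQ_unique unfolding r_def by fastforce
  qed
qed

theorem theorem5p6:
  fixes \<Theta> :: "'n::finite luk_form set"
  assumes "\<exists>v u. v \<in> Mod \<Theta> \<and> rational_point v \<and>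
             bouligand_severi_tangent (Mod \<Theta>) v u \<and> rational_vector u \<and> outgoing (Mod \<Theta>) v u"
  shows "mv_semisimple (LIND (Th (Mod \<Theta>))) \<and> \<not> mv_strongly_semisimple (LIND (Th (Mod \<Theta>)))"
proof
  interpret cube_subset "Mod \<Theta>" by standard (auto simp: Mod_def)
  show "mv_semisimple (LIND (Th (Mod \<Theta>)))" by (rule semisimple_A)
  obtain v u where v: "v \<in> Mod \<Theta>" "rational_point v"
    and tangent: "bouligand_severi_tangent (Mod \<Theta>) v u"
    and u: "rational_vector u" "outgoing (Mod \<Theta>) v u"
    using assms by blast
  from tangent obtain s where s: "\<And>i. s i \<in> Mod \<Theta> - {v}" "s \<longlonglongrightarrow> v"
    "(\<lambda>i. (s i - v) /\<^sub>R norm (s i - v)) \<longlonglongrightarrow> u"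
    unfolding bouligand_severi_tangent_def by blast
  obtain f g where fg: "\<And>x. x \<in> Mod \<Theta> \<Longrightarrow> luk_eval f x = 0 \<Longrightarrow> x = v" "luk_eval g v = 0"
    "(\<lambda>i. luk_eval f (s i) / norm (s i - v)) \<longlonglongrightarrow> 0"
    "\<not> (\<lambda>i. luk_eval g (s i) / norm (s i - v)) \<longlonglongrightarrow> 0"
    by (rule rational_outgoing_tangent_formulas[OF subset_cube v u s]) (rule that)
  show "\<not> mv_strongly_semisimple (LIND (Th (Mod \<Theta>)))"
    by (rule not_strongly_semisimple[OF compact_Mod fg(1,2) _ _ fg(3,4)]) (use s(1) in auto)
qed

end
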